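(* There exist absolute constants $c, c' > 0$ such that for all positive integers $m$, $$2^{c \cdot m \log m} \leq ER_B(m) \leq 2^{c' \cdot m \log m},$$ where $ER_B(m)$ denotes the bipartite Erdős–Rado number.
   Context: For a positive integer $n$, $K_{n,n}$ is the complete bipartite graph with two vertex classes (left and right) of size $n$ each; its edges are written as pairs $(a,b)$ with $a$ in the left class and $b$ in the right class. A copy of $K_{m,m}$ in $K_{n,n}$ is the complete bipartite subgraph spanned by an $m$-element subset $A'$ of the left class and an $m$-element subset $B'$ of the right class, so its edges are the pairs in $A' \times B'$. For a positive integer $m$, the bipartite Erdős–Rado number $ER_B(m)$ is the least positive integer $n$ such that for every coloring $\Delta: E(K_{n,n}) \to \mathbb{N}$ (with no bound on the number of colors used) there exists a copy of $K_{m,m}$ in $K_{n,n}$ for which at least one of the following four patterns holds: 1. (monochromatic) for all edges $(a_1,b_1),(a_2,b_2)$ of the copy, $\Delta(a_1,b_1)=\Delta(a_2,b_2)$; 2. (left-colored) for all edges $(a_1,b_1),(a_2,b_2)$ of the copy, $\Delta(a_1,b_1)=\Delta(a_2,b_2)$ if and only if $a_1=a_2$; 3. (right-colored) for all edges $(a_1,b_1),(a_2,b_2)$ of the copy, $\Delta(a_1,b_1)=\Delta(a_2,b_2)$ if and only if $b_1=b_2$; 4. (rainbow) for all edges $(a_1,b_1),(a_2,b_2)$ of the copy, $\Delta(a_1,b_1)=\Delta(a_2,b_2)$ if and only if both $a_1=a_2$ and $b_1=b_2$. Such an $n$ exists for every positive integer $m$ (a theorem of Rado), so $ER_B(m)$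 is well defined and finite. The logarithm may be taken to base 2 (the choice of base only affects the constants). *)

theory Defs
  imports Complex_Main
begin

text \<open>
  Both vertex classes of \<open>K\<^bsub>n,n\<^esub>\<close> are represented by \<open>{..<n}\<close>; the two classes are kept apart by
  the position in the ordered pair \<open>(a, b)\<close>, left vertex first.
\<close>

definition is_copy :: "nat \<Rightarrow> nat \<Rightarrow> nat set \<Rightarrow> nat set \<Rightarrow> bool" where
  "is_copy m n A B \<longleftrightarrow> A \<subseteq> {..<n} \<and> B \<subseteq> {..<n} \<and> card A = m \<and> card B = m"

definition monochromatic :: "(nat \<times> nat \<Rightarrow> nat) \<Rightarrow> (nat \<times> nat) set \<Rightarrow> bool" where
  "monochromatic \<Delta> E \<longleftrightarrow>
     (\<forall>(a1, b1) \<in> E. \<forall>(a2, b2) \<in> E. \<Delta> (a1, b1) = \<Delta> (a2, b2))"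

definition left_colored :: "(nat \<times> nat \<Rightarrow> nat) \<Rightarrow> (nat \<times> nat) set \<Rightarrow> bool" where
  "left_colored \<Delta> E \<longleftrightarrow>
     (\<forall>(a1, b1) \<in> E. \<forall>(a2, b2) \<in> E. \<Delta> (a1, b1) = \<Delta> (a2, b2) \<longleftrightarrow> a1 = a2)"

definition right_colored :: "(nat \<times> nat \<Rightarrow> nat) \<Rightarrow> (nat \<times> nat) set \<Rightarrow> bool" where
  "right_colored \<Delta> E \<longleftrightarrow>
     (\<forall>(a1, b1) \<in> E. \<forall>(a2, b2) \<in> E. \<Delta> (a1, b1) = \<Delta> (a2, b2) \<longleftrightarrow> b1 = b2)"

definition rainbow :: "(nat \<times> nat \<Rightarrow> nat) \<Rightarrow> (nat \<times> nat) set \<Rightarrow> bool" where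
  "rainbow \<Delta> E \<longleftrightarrow>
     (\<forall>(a1, b1) \<in> E. \<forall>(a2, b2) \<in> E. \<Delta> (a1, b1) = \<Delta> (a2, b2) \<longleftrightarrow> a1 = a2 \<and> b1 = b2)"

text \<open>
  A coloring is a total function on pairs; its values outside \<open>{..<n} \<times> {..<n}\<close> play no role, because
  the edges of every copy lie in that set.
\<close>

definition canonical_copy_property :: "nat \<Rightarrow> nat \<Rightarrow> bool" where
  "canonical_copy_property m n \<longleftrightarrow>
     (\<forall>\<Delta> :: nat \<times> nat \<Rightarrow> nat. \<exists>A B. is_copy m n A B \<and>
        (monochromatic \<Delta> (A \<times> B) \<or> left_colored \<Delta> (A \<times> B) \<or>
         right_colored \<Delta> (A \<times> B) \<or> rainbow \<Delta> (A \<times> B)))"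

text \<open>
  If no \<open>n\<close> had the property, \<open>LEAST\<close> would be unspecified; that this does not happen for positive
  \<open>m\<close> is Rado's theorem.
\<close>

definition ER_B :: "nat \<Rightarrow> nat" where
  "ER_B m = (LEAST n. n > 0 \<and> canonical_copy_property m n)"

end

theory Submission
  imports Defs "HOL-Library.FuncSet"
begin

text \<open>
  Upper bound, with \<open>n = m ^ (8 * m)\<close>. Call a vertex popular if some color occurs on at least a
  \<open>1/(2m\<^sup>4)\<close> proportion of its edges. If half of the right vertices are popular, each of them is
  constant on a proportion \<open>1/(2m\<^sup>5)\<^bsup>m\<^esup>\<close> of the \<open>m\<close>-subsets of the left class, so by averaging some
  \<open>m\<close>-subset is constant for \<open>m\<^sup>2\<close> right vertices; among these, \<open>m\<close> share their color or \<open>m\<close> have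
  distinct colors. The same holds with the sides exchanged. Otherwise, between the two halves of
  unpopular vertices, any two given edges of a random copy collide with probability at most
  \<open>1/m\<^sup>4\<close>, and a union bound over the fewer than \<open>m\<^sup>4\<close> pairs of edges gives a rainbow copy.

  Lower bound: \<open>m\<^sup>2 - 1\<close> colors exclude rainbow copies. In each of the other patterns all rows or
  all columns of the copy are constant, and counting shows that few colorings admit such a copy.
\<close>

section \<open>Upper bound: vertices with a popular color\<close>

text \<open>Pigeonhole: if \<open>f\<close> takes at least \<open>m\<close> values, one preimage for
  each of \<open>m\<close> values works. Otherwise some fibre has \<open>m\<close> points, since
  fewer than \<open>m\<close> fibres of size at most \<open>m\<close> cannot cover
  \<open>m * m\<close> points.\<close>

lemma constant_or_injective_subset:
  assumes "finite X" and "m * m \<le> card X"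
  obtains Y where "Y \<subseteq> X" "card Y = m" "(\<exists>c. \<forall>x\<in>Y. f x = c) \<or> inj_on f Y"
proof (cases "m \<le> card (f ` X)")
  case True
  then obtain S where S: "S \<subseteq> f ` X" "card S = m"
    by (meson obtain_subset_with_card_n)
  then obtain Y where "Y \<subseteq> X" "inj_on f Y" "S = f ` Y"
    by (auto simp: subset_image_inj)
  then show ?thesis using that S by (metis card_image)
next
  case False
  have "\<exists>c. m \<le> card {x \<in> X. f x = c}"
  proof (rule ccontr)
    assume "\<not> ?thesis"
    then have small: "card {x \<in> X. f x = c} \<le> m" for c
      by (meson nat_le_linear)
    have "card X = card (\<Union>c\<in>f ` X. {x \<in> X. f x = c})"
      by (rule arg_cong[where f = card]) auto
    also have "\<dots> \<le> (\<Sum>c\<in>f ` X. card {x \<in> X. f x = c})"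
      using assms(1) by (intro card_UN_le) auto
    also have "\<dots> \<le> card (f ` X) * m"
      using sum_bounded_above[of "f ` X" "\<lambda>c. card {x \<in> X. f x = c}" m] small by simp
    also have "\<dots> < m * m" using False by simp
    finally show False using assms(2) by simp
  qed
  then obtain c Y where "Y \<subseteq> {x \<in> X. f x = c}" "card Y = m"
    by (meson obtain_subset_with_card_n)
  then show ?thesis using that[of Y] by (metis (mono_tags, lifting) mem_Collect_eq subset_iff)
qed

text \<open>Double counting of the pairs \<open>(A, b)\<close> with column \<open>b\<close> constant
  on the \<open>m\<close>-subset \<open>A\<close>. The popular color class of \<open>b\<close>, of
  size s, contributes s choose m, hence at least (s/m)^m sets, which is at least
  \<open>(card X / (d * m)) ^ m\<close>. If every \<open>A\<close> served fewer than
  \<open>K\<close> columns, there would be fewer than \<open>K * card X ^ m\<close> pairs. The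
  assumption \<open>large\<close> ensures s \<ge> m, as the binomial estimate requires.\<close>

lemma many_columns_constant:
  fixes \<Delta> :: "'a \<Rightarrow> 'b \<Rightarrow> 'c"
  assumes X: "finite X" and G: "finite G" and "m > 0" "d > 0" and large: "d * m \<le> card X"
    and pop: "\<And>b. b \<in> G \<Longrightarrow> \<exists>c. card X \<le> d * card {a \<in> X. \<Delta> a b = c}"
    and card_G: "K * (d * m) ^ m \<le> card G"
  obtains A where "A \<subseteq> X" "card A = m" "K \<le> card {b \<in> G. \<exists>c. \<forall>a\<in>A. \<Delta> a b = c}"
proof (rule ccontr)
  assume no: "\<not> thesis"
  note thesisI = that
  define T where "T = {A. A \<subseteq> X \<and> card A = m}"
  define R where "R = (\<lambda>A b. \<exists>c. \<forall>a\<in>A. \<Delta> a b = c)"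
  have T: "finite T" "card T = card X choose m"
    unfolding T_def using X by (auto simp: n_subsets)
  have "m \<le> card X" using large \<open>d > 0\<close> by (cases d) auto
  have few: "card {b \<in> G. R A b} < K" if "A \<in> T" for A
  proof (rule ccontr)
    assume "\<not> ?thesis"
    then show False using no \<open>A \<in> T\<close> thesisI[of A] by (simp add: T_def R_def)
  qed
  have many: "(real (card X) / (d * m)) ^ m \<le> card {A \<in> T. R A b}" if b: "b \<in> G" for b
  proof -
    from pop[OF b] obtain c where c: "card X \<le> d * card {a \<in> X. \<Delta> a b = c}" ..
    let ?C = "{a \<in> X. \<Delta> a b = c}"
    have "d * m \<le> d * card ?C" using c large by linarith
    then have mC: "m \<le> card ?C" using \<open>d > 0\<close> by simp
    have "real (card X) \<le> real d * real (card ?C)"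
      using c by (metis of_nat_le_iff of_nat_mult)
    then have "real (card X) / (d * m) \<le> real (card ?C) / m"
      using \<open>d > 0\<close> \<open>m > 0\<close> by (simp add: field_simps)
    then have "(real (card X) / (d * m)) ^ m \<le> (real (card ?C) / m) ^ m"
      by (intro power_mono) auto
    also have "\<dots> \<le> real (card ?C choose m)"
      using binomial_ge_n_over_k_pow_k[OF mC] by simp
    also have "card ?C choose m = card {A. A \<subseteq> ?C \<and> card A = m}"
      using X by (simp add: n_subsets)
    also have "\<dots> \<le> card {A \<in> T. R A b}"
    proof (rule card_mono)
      show "{A. A \<subseteq> ?C \<and> card A = m} \<subseteq> {A \<in> T. R A b}" unfolding T_def R_def by blast
    qed (use T(1) in simp)
    finally show ?thesis by simp
  qed
  \<comment> \<open>The strict inequality between the sums over \<open>T\<close> below needs at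
    least one summand.\<close>
  have "T \<noteq> {}" using T \<open>m \<le> card X\<close> by (metis binomial_eq_0_iff card.empty not_le)
  have "card G * (real (card X) / (d * m)) ^ m \<le> (\<Sum>b\<in>G. real (card {A \<in> T. R A b}))"
    using sum_bounded_below[of G "(real (card X) / (d * m)) ^ m"] many by simp
  also have "\<dots> = real (\<Sum>A\<in>T. card {b \<in> G. R A b})"
    using sum_multicount_gen[of T G R "\<lambda>b. card {A \<in> T. R A b}"] T G by simp
  also have "(\<Sum>A\<in>T. card {b \<in> G. R A b}) < (\<Sum>A\<in>T. K)"
    using few T \<open>T \<noteq> {}\<close> by (intro sum_strict_mono) auto
  also have "\<dots> \<le> K * card X ^ m"
    using binomial_le_pow[OF \<open>m \<le> card X\<close>] T by simp
  finally have "real (card G) * real (card X) ^ m < K * real (card X) ^ m * (d * m) ^ m"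
    using \<open>d > 0\<close> \<open>m > 0\<close> by (simp add: power_divide divide_less_eq)
  then have "real (card X) ^ m * real (card G) < real (card X) ^ m * real (K * (d * m) ^ m)"
    by (simp add: algebra_simps)
  then have "card G < K * (d * m) ^ m"
    by (smt (verit) mult_left_mono of_nat_0_le_iff of_nat_less_iff zero_le_power)
  then show False using card_G by simp
qed

section \<open>Upper bound: rainbow copies by random choice\<close>

text \<open>Conditioning in counting form: choose a function uniformly and fix all its values except
  the one at \<open>l\<close>. If the event has proportion at most 1/d in each such fibre, it has
  proportion at most 1/d overall.\<close>

lemma card_PiE_fibre_bound:
  assumes I: "finite I" "l \<in> I" and R: "finite R"
    and fibre: "\<And>g. g \<in> PiE (I - {l}) (\<lambda>_. R) \<Longrightarrow> d * card {x \<in> R. P (g(l := x))} \<le> card R"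
  shows "d * card {g \<in> PiE I (\<lambda>_. R). P g} \<le> card (PiE I (\<lambda>_. R))"
proof -
  let ?H = "PiE (I - {l}) (\<lambda>_. R)"
  let ?S = "SIGMA g:?H. {x \<in> R. P (g(l := x))}"
  have eq: "PiE I (\<lambda>_. R) = (\<lambda>(x, g). g(l := x)) ` (R \<times> ?H)"
    using PiE_insert_eq[of l "I - {l}" "\<lambda>_. R"] I by (simp add: insert_absorb)
  have fin: "finite ?H" using I R by (intro finite_PiE) auto
  then have finS: "finite ?S" using R by (intro finite_SigmaI) auto
  have "{g \<in> PiE I (\<lambda>_. R). P g} \<subseteq> (\<lambda>(g, x). g(l := x)) ` ?S"
    unfolding eq by force
  then have "card {g \<in> PiE I (\<lambda>_. R). P g} \<le> card ?S"
    using finS by (meson card_image_le card_mono finite_imageI order_trans)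
  also have "card ?S = (\<Sum>g\<in>?H. card {x \<in> R. P (g(l := x))})"
    using fin R by (intro card_SigmaI) auto
  finally have "d * card {g \<in> PiE I (\<lambda>_. R). P g} \<le> (\<Sum>g\<in>?H. d * card {x \<in> R. P (g(l := x))})"
    by (simp add: sum_distrib_left[symmetric])
  also have "\<dots> \<le> (\<Sum>g\<in>?H. card R)" using fibre by (intro sum_mono)
  also have "\<dots> = card R ^ Suc (card (I - {l}))" using I by (simp add: card_PiE)
  also have "\<dots> = card (PiE I (\<lambda>_. R))"
    unfolding card.remove[OF I, symmetric] using I by (simp add: card_PiE)
  finally show ?thesis .
qed

text \<open>The same conditioning for a random pair, with the first component fixed.\<close>

lemma card_pairs_bound:
  assumes "finite F" "finite G" "\<And>f. f \<in> F \<Longrightarrow> d * card {g \<in> G. P f g} \<le> card G"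
  shows "d * card {(f, g) \<in> F \<times> G. P f g} \<le> card (F \<times> G)"
proof -
  have "{(f, g) \<in> F \<times> G. P f g} = (SIGMA f:F. {g \<in> G. P f g})" by auto
  then have "d * card {(f, g) \<in> F \<times> G. P f g} = (\<Sum>f\<in>F. d * card {g \<in> G. P f g})"
    using assms by (simp add: sum_distrib_left)
  also have "\<dots> \<le> (\<Sum>f\<in>F. card G)" using assms by (intro sum_mono)
  finally show ?thesis by (simp add: card_cartesian_product)
qed

lemma rainbow_copy:
  fixes \<Delta> :: "'a \<Rightarrow> 'b \<Rightarrow> 'c"
  assumes X: "finite X" "X \<noteq> {}" and Y: "finite Y" "Y \<noteq> {}" and "m > 0"
    and col: "\<And>b c. b \<in> Y \<Longrightarrow> m ^ 4 * card {a \<in> X. \<Delta> a b = c} \<le> card X"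
    and row: "\<And>a c. a \<in> X \<Longrightarrow> m ^ 4 * card {b \<in> Y. \<Delta> a b = c} \<le> card Y"
  obtains A B where "A \<subseteq> X" "B \<subseteq> Y" "card A = m" "card B = m" "inj_on (\<lambda>(a, b). \<Delta> a b) (A \<times> B)"
proof -
  \<comment> \<open>A random copy is a pair of arbitrary maps from \<open>I\<close>, repetitions
    allowed, so that the coordinates are independent. Injectivity is recovered at the end from the
    absence of collisions.\<close>
  define I where "I = {..<m}"
  define F where "F = PiE I (\<lambda>_. X)"
  define G where "G = PiE I (\<lambda>_. Y)"
  have I: "finite I" "card I = m" unfolding I_def by auto
  have F: "finite F" "F \<noteq> {}" unfolding F_def using X I by (auto intro!: finite_PiE simp: PiE_eq_empty_iff)
  have G: "finite G" "G \<noteq> {}" unfolding G_def using Y I by (auto intro!: finite_PiE simp: PiE_eq_empty_iff)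
  define coll where "coll = (\<lambda>((i, j), (k, l)). {(f, g) \<in> F \<times> G. \<Delta> (f i) (g j) = \<Delta> (f k) (g l)})"
  define Q where "Q = {(p, q) \<in> (I \<times> I) \<times> (I \<times> I). p \<noteq> q}"
  have coll_small: "m ^ 4 * card (coll q) \<le> card (F \<times> G)" if "q \<in> Q" for q
  proof -
    obtain i j k l where q: "q = ((i, j), (k, l))" by (metis surj_pair)
    with that have ij: "i \<in> I" "j \<in> I" "k \<in> I" "l \<in> I" "(i, j) \<noteq> (k, l)" by (auto simp: Q_def)
    show ?thesis
    proof (cases "j = l")
      case False
      \<comment> \<open>Fix \<open>f\<close> and every value of \<open>g\<close> except
        \<open>g l\<close>. The color of the first edge is then fixed, and \<open>row\<close> at the
        vertex \<open>f k\<close> bounds the choices of \<open>g l\<close> that reproduce it,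
        whether or not \<open>i = k\<close>.\<close>
      have "m ^ 4 * card {g \<in> G. \<Delta> (f i) (g j) = \<Delta> (f k) (g l)} \<le> card G" if f: "f \<in> F" for f
        unfolding G_def
      proof (rule card_PiE_fibre_bound[OF I(1) ij(4) Y(1)])
        fix g :: "nat \<Rightarrow> 'b"
        have "f k \<in> X" using f ij by (auto simp: F_def)
        from row[OF this, of "\<Delta> (f i) (g j)"]
        show "m ^ 4 * card {x \<in> Y. \<Delta> (f i) ((g(l := x)) j) = \<Delta> (f k) ((g(l := x)) l)} \<le> card Y"
          using False by (simp add: eq_commute[of "\<Delta> (f i) (g j)"])
      qed
      then show ?thesis using card_pairs_bound[OF F(1) G(1)] by (simp add: q coll_def)
    next
      case True
      with ij have ik: "i \<noteq> k" by auto
      \<comment> \<open>Both edges now end in the same right vertex, so \<open>f k\<close> is varied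
        instead and \<open>col\<close> applies.\<close>
      have "m ^ 4 * card {f \<in> F. \<Delta> (f i) (g j) = \<Delta> (f k) (g l)} \<le> card F" if g: "g \<in> G" for g
        unfolding F_def
      proof (rule card_PiE_fibre_bound[OF I(1) ij(3) X(1)])
        fix f :: "nat \<Rightarrow> 'a"
        have "g l \<in> Y" using g ij by (auto simp: G_def)
        from col[OF this, of "\<Delta> (f i) (g j)"]
        show "m ^ 4 * card {x \<in> X. \<Delta> ((f(k := x)) i) (g j) = \<Delta> ((f(k := x)) k) (g l)} \<le> card X"
          using ik by (simp add: eq_commute[of "\<Delta> (f i) (g j)"])
      qed
      \<comment> \<open>Here \<open>g\<close> is the component held fixed, so the pairs are counted
        in swapped order and carried back by \<open>prod.swap\<close>.\<close>
      then have "m ^ 4 * card {(g, f) \<in> G \<times> F. \<Delta> (f i) (g j) = \<Delta> (f k) (g l)} \<le> card (G \<times> F)"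
        using card_pairs_bound[OF G(1) F(1), of _ "\<lambda>g f. \<Delta> (f i) (g j) = \<Delta> (f k) (g l)"] by simp
      moreover have "coll q = prod.swap ` {(g, f) \<in> G \<times> F. \<Delta> (f i) (g j) = \<Delta> (f k) (g l)}"
        by (auto simp: q coll_def image_iff)
      ultimately show ?thesis
        by (simp add: card_image inj_on_def card_cartesian_product mult.commute)
    qed
  qed
  have Q: "finite Q" "card Q < m ^ 4"
  proof -
    \<comment> \<open>One excluded diagonal element makes \<open>card Q\<close> strictly less than
      \<open>m ^ 4\<close>. As each collision has proportion at most 1/m^4, the union bound then
      stays strictly below the whole space.\<close>
    have "((0, 0), (0, 0)) \<in> (I \<times> I) \<times> (I \<times> I)" using \<open>m > 0\<close> by (auto simp: I_def)
    then have psub: "Q \<subset> (I \<times> I) \<times> (I \<times> I)" by (auto simp: Q_def)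
    have fin: "finite ((I \<times> I) \<times> (I \<times> I))" using I by auto
    have "finite Q" "card Q < card ((I \<times> I) \<times> (I \<times> I))"
      using psub fin by (metis finite_subset psubset_imp_subset, metis psubset_card_mono)
    then show "finite Q" "card Q < m ^ 4"
      by (simp_all add: card_cartesian_product I power4_eq_xxxx mult.assoc)
  qed
  have FG: "finite (F \<times> G)" "card (F \<times> G) > 0" using F G by (auto simp: card_gt_0_iff)
  have "m ^ 4 * card (\<Union>q\<in>Q. coll q) \<le> m ^ 4 * (\<Sum>q\<in>Q. card (coll q))"
    using Q by (intro mult_le_mono2 card_UN_le)
  also have "\<dots> \<le> (\<Sum>q\<in>Q. card (F \<times> G))"
    unfolding sum_distrib_left using coll_small by (intro sum_mono)
  also have "\<dots> < m ^ 4 * card (F \<times> G)" using Q FG by simp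
  finally have "card (\<Union>q\<in>Q. coll q) < card (F \<times> G)" by simp
  moreover have "finite (\<Union>q\<in>Q. coll q)"
    by (rule finite_subset[OF _ FG(1)]) (auto simp: coll_def)
  ultimately have "\<not> F \<times> G \<subseteq> (\<Union>q\<in>Q. coll q)" by (meson card_mono not_le)
  then obtain f g where fg: "f \<in> F" "g \<in> G" "(f, g) \<notin> (\<Union>q\<in>Q. coll q)"
    by blast
  then have inj: "i = k \<and> j = l"
    if "\<Delta> (f i) (g j) = \<Delta> (f k) (g l)" "i \<in> I" "j \<in> I" "k \<in> I" "l \<in> I" for i j k l
    using that by (force simp: Q_def coll_def)
  \<comment> \<open>A repeated vertex would already produce equal colors at two different index
    pairs.\<close>
  have "inj_on f I" "inj_on g I" using inj by (metis inj_onI)+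
  show thesis
  proof (rule that[of "f ` I" "g ` I"])
    show "f ` I \<subseteq> X" "g ` I \<subseteq> Y" using fg by (auto simp: F_def G_def)
    show "card (f ` I) = m" "card (g ` I) = m"
      using \<open>inj_on f I\<close> \<open>inj_on g I\<close> I by (simp_all add: card_image)
    show "inj_on (\<lambda>(a, b). \<Delta> a b) (f ` I \<times> g ` I)"
      unfolding inj_on_def using inj by fastforce
  qed
qed

section \<open>Upper bound: the case distinction for \<open>n = m ^ (8 * m)\<close>\<close>

text \<open>The final alternative for the column colors \<open>f\<close> separates monochromatic
  from right-colored copies. The coloring takes its two arguments separately, so that its transpose
  yields the statement for rows.\<close>

lemma popular_columns:
  fixes \<Delta> :: "nat \<Rightarrow> nat \<Rightarrow> nat"
  assumes "m \<ge> 2" and n: "n = m ^ (8 * m)"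
    and half: "n \<le> 2 * card {b \<in> {..<n}. \<exists>c. n \<le> 2 * m ^ 4 * card {a \<in> {..<n}. \<Delta> a b = c}}"
  obtains A B f where "is_copy m n A B" "\<forall>a\<in>A. \<forall>b\<in>B. \<Delta> a b = f b"
    "(\<exists>c. \<forall>x\<in>B. f x = c) \<or> inj_on f B"
proof -
  define G where "G = {b \<in> {..<n}. \<exists>c. n \<le> 2 * m ^ 4 * card {a \<in> {..<n}. \<Delta> a b = c}}"
  \<comment> \<open>The averaging is used with \<open>d = 2 * m ^ 4\<close> and
    \<open>K = m * m\<close>; the outer factor 2 accounts for only half of the columns being
    popular. Every 2 is absorbed into an \<open>m\<close>, and 6m + 3 \<le> 8m because m \<ge>
    2.\<close>
  have "2 * (m * m * (2 * m ^ 4 * m) ^ m) \<le> m * (m * m * (m * m ^ 4 * m) ^ m)"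
    using assms(1) by (intro mult_mono power_mono) auto
  also have "\<dots> = m ^ (6 * m + 3)"
    by (simp add: power_add power_mult eval_nat_numeral algebra_simps)
  also have "\<dots> \<le> n" unfolding n using assms(1) by (intro power_increasing) auto
  finally have card_G: "m * m * (2 * m ^ 4 * m) ^ m \<le> card G" using half by (simp add: G_def)
  have "2 * m ^ 4 * m \<le> m * m ^ 4 * m" using assms(1) by simp
  also have "\<dots> = m ^ 6" by (simp add: eval_nat_numeral)
  also have "\<dots> \<le> n" unfolding n using assms(1) by (intro power_increasing) auto
  finally have large: "2 * m ^ 4 * m \<le> card {..<n}" by simp
  obtain A where A: "A \<subseteq> {..<n}" "card A = m" "m * m \<le> card {b \<in> G. \<exists>c. \<forall>a\<in>A. \<Delta> a b = c}"
    by (rule many_columns_constant[of "{..<n}" G m "2 * m ^ 4" \<Delta> "m * m"])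
       (use assms(1) large card_G in \<open>auto simp: G_def\<close>)
  \<comment> \<open>The columns concerned are constant on \<open>A\<close>, so their colors can be
    read off at the single vertex \<open>a0\<close>.\<close>
  obtain a0 where a0: "a0 \<in> A" using A(2) assms(1) by (metis card.empty ex_in_conv not_numeral_le_zero)
  obtain B where B: "B \<subseteq> {b \<in> G. \<exists>c. \<forall>a\<in>A. \<Delta> a b = c}" "card B = m"
    "(\<exists>c. \<forall>x\<in>B. \<Delta> a0 x = c) \<or> inj_on (\<Delta> a0) B"
    by (rule constant_or_injective_subset[OF _ A(3), of "\<Delta> a0"]) (auto simp: G_def)
  show thesis
  proof (rule that)
    show "is_copy m n A B" using A B by (auto simp: is_copy_def G_def)
    show "\<forall>a\<in>A. \<forall>b\<in>B. \<Delta> a b = \<Delta> a0 b" using B(1) a0 by fastforce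
  qed (fact B(3))
qed

lemma canonical_copy_property_pow:
  assumes "m \<ge> 2"
  shows "canonical_copy_property m (m ^ (8 * m))"
  unfolding canonical_copy_property_def
proof
  fix \<Delta> :: "nat \<times> nat \<Rightarrow> nat"
  define n where "n = m ^ (8 * m)"
  define G where "G = {b \<in> {..<n}. \<exists>c. n \<le> 2 * m ^ 4 * card {a \<in> {..<n}. \<Delta> (a, b) = c}}"
  define H where "H = {a \<in> {..<n}. \<exists>c. n \<le> 2 * m ^ 4 * card {b \<in> {..<n}. \<Delta> (a, b) = c}}"
  have "n > 0" unfolding n_def using assms by simp
  consider "n \<le> 2 * card G" | "n \<le> 2 * card H" | "n > 2 * card G" "n > 2 * card H" by linarith
  then have "\<exists>A B. is_copy m n A B \<and>
        (monochromatic \<Delta> (A \<times> B) \<or> left_colored \<Delta> (A \<times> B) \<or>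
         right_colored \<Delta> (A \<times> B) \<or> rainbow \<Delta> (A \<times> B))"
  proof cases
    case 1
    obtain A B f where AB: "is_copy m n A B" "\<forall>a\<in>A. \<forall>b\<in>B. \<Delta> (a, b) = f b"
      "(\<exists>c. \<forall>x\<in>B. f x = c) \<or> inj_on f B"
      by (rule popular_columns[OF assms n_def 1[unfolded G_def]])
    from AB(3) have "monochromatic \<Delta> (A \<times> B) \<or> right_colored \<Delta> (A \<times> B)"
    proof
      assume "\<exists>c. \<forall>x\<in>B. f x = c"
      then show ?thesis using AB(2) by (auto simp: monochromatic_def)
    next
      assume "inj_on f B"
      then show ?thesis using AB(2) by (simp add: right_colored_def inj_on_eq_iff)
    qed
    then show ?thesis using AB(1) by blast
  next
    case 2
    \<comment> \<open>The lemma on columns is applied to the transposed coloring, which exchanges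
      the roles of \<open>A\<close> and \<open>B\<close>.\<close>
    obtain B A f where AB: "is_copy m n B A" "\<forall>b\<in>B. \<forall>a\<in>A. \<Delta> (a, b) = f a"
      "(\<exists>c. \<forall>x\<in>A. f x = c) \<or> inj_on f A"
      by (rule popular_columns[OF assms n_def 2[unfolded H_def]])
    from AB(3) have "monochromatic \<Delta> (A \<times> B) \<or> left_colored \<Delta> (A \<times> B)"
    proof
      assume "\<exists>c. \<forall>x\<in>A. f x = c"
      then show ?thesis using AB(2) by (auto simp: monochromatic_def)
    next
      assume "inj_on f A"
      then show ?thesis using AB(2) by (simp add: left_colored_def inj_on_eq_iff)
    qed
    then show ?thesis using AB(1) by (auto simp: is_copy_def)
  next
    case 3
    define X where "X = {..<n} - H"
    define Y where "Y = {..<n} - G"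
    have fin: "finite X" "finite Y" unfolding X_def Y_def by auto
    have "card X = n - card H" "card Y = n - card G"
      unfolding X_def Y_def by (subst card_Diff_subset; force simp: G_def H_def)+
    then have XY: "n \<le> 2 * card X" "n \<le> 2 * card Y" using 3 by auto
    then have ne: "X \<noteq> {}" "Y \<noteq> {}" using \<open>n > 0\<close> by auto
    \<comment> \<open>The factor 2 in the popularity threshold pays for passing from all
      \<open>n\<close> vertices to \<open>X\<close> or \<open>Y\<close>, which contain at least half
      of them.\<close>
    have col: "m ^ 4 * card {a \<in> X. \<Delta> (a, b) = c} \<le> card X" if "b \<in> Y" for b c
    proof -
      have "card {a \<in> X. \<Delta> (a, b) = c} \<le> card {a \<in> {..<n}. \<Delta> (a, b) = c}"
        by (intro card_mono) (auto simp: X_def)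
      then have "2 * m ^ 4 * card {a \<in> X. \<Delta> (a, b) = c} \<le> 2 * m ^ 4 * card {a \<in> {..<n}. \<Delta> (a, b) = c}"
        by (rule mult_le_mono2)
      also have "\<dots> < n" using that by (auto simp: Y_def G_def not_le)
      finally show ?thesis using XY by simp
    qed
    have row: "m ^ 4 * card {b \<in> Y. \<Delta> (a, b) = c} \<le> card Y" if "a \<in> X" for a c
    proof -
      have "card {b \<in> Y. \<Delta> (a, b) = c} \<le> card {b \<in> {..<n}. \<Delta> (a, b) = c}"
        by (intro card_mono) (auto simp: Y_def)
      then have "2 * m ^ 4 * card {b \<in> Y. \<Delta> (a, b) = c} \<le> 2 * m ^ 4 * card {b \<in> {..<n}. \<Delta> (a, b) = c}"
        by (rule mult_le_mono2)
      also have "\<dots> < n" using that by (auto simp: X_def H_def not_le)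
      finally show ?thesis using XY by simp
    qed
    obtain A B where AB: "A \<subseteq> X" "B \<subseteq> Y" "card A = m" "card B = m"
      "inj_on (\<lambda>(a, b). \<Delta> (a, b)) (A \<times> B)"
      by (rule rainbow_copy[of X Y m "\<lambda>a b. \<Delta> (a, b)"]) (use fin ne col row assms in auto)
    then have "is_copy m n A B" by (auto simp: is_copy_def X_def Y_def)
    moreover have "rainbow \<Delta> (A \<times> B)"
      using AB(5) by (auto simp: rainbow_def inj_on_def)
    ultimately show ?thesis by blast
  qed
  then show "\<exists>A B. is_copy m (m ^ (8 * m)) A B \<and>
        (monochromatic \<Delta> (A \<times> B) \<or> left_colored \<Delta> (A \<times> B) \<or>
         right_colored \<Delta> (A \<times> B) \<or> rainbow \<Delta> (A \<times> B))"
    unfolding n_def .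
qed

section \<open>Lower bound: counting colorings\<close>

text \<open>The map \<open>p\<close> leads from each point of \<open>D\<close> to a point outside
  \<open>D\<close> with the same value, so a function in \<open>S\<close> is recovered from its
  restriction to \<open>U - D\<close>.\<close>

lemma card_determined_functions:
  assumes U: "finite U" "D \<subseteq> U" and S: "S \<subseteq> PiE U (\<lambda>_. {..<q::nat})"
    and det: "\<And>f x. f \<in> S \<Longrightarrow> x \<in> D \<Longrightarrow> p x \<in> U - D \<and> f x = f (p x)"
  shows "card S \<le> q ^ (card U - card D)"
proof -
  have "inj_on (\<lambda>f. restrict f (U - D)) S"
  proof (rule inj_onI)
    fix f g assume fg: "f \<in> S" "g \<in> S" "restrict f (U - D) = restrict g (U - D)"
    have eq: "f x = g x" if "x \<in> U - D" for x
      using fun_cong[OF fg(3), of x] that by (simp del: Diff_iff)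
    show "f = g"
    proof (rule PiE_ext)
      show "f \<in> PiE U (\<lambda>_. {..<q})" "g \<in> PiE U (\<lambda>_. {..<q})" using fg S by auto
      fix x assume "x \<in> U"
      show "f x = g x"
      proof (cases "x \<in> D")
        case True
        then show ?thesis using det[OF fg(1) True] det[OF fg(2) True] eq by simp
      next
        case False
        then show ?thesis using eq \<open>x \<in> U\<close> by simp
      qed
    qed
  qed
  moreover have "(\<lambda>f. restrict f (U - D)) ` S \<subseteq> PiE (U - D) (\<lambda>_. {..<q})"
    using S by fastforce
  ultimately have "card S \<le> card (PiE (U - D) (\<lambda>_. {..<q}))"
    using U by (intro card_inj_on_le) (auto intro!: finite_PiE)
  also have "\<dots> = q ^ (card U - card D)"
    using U by (simp add: card_PiE card_Diff_subset finite_subset)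
  finally show ?thesis .
qed

text \<open>A copy with constant rows or columns leaves m(m-1) of its entries determined, so a union
  bound over copies gives q^(m(m-1)) \<le> 2 (n choose m)^2 for q = m^2 - 1. Crude estimates and an
  m-th root turn this into \<open>q ^ (m - 1) \<le> n ^ 4\<close>.\<close>

lemma canonical_copy_property_lower:
  assumes m: "m \<ge> 2" and canon: "canonical_copy_property m n"
  shows "m ^ m \<le> n ^ 8"
proof -
  define q where "q = m * m - 1"
  define U where "U = {..<n} \<times> {..<n}"
  \<comment> \<open>Extensional functions represent each coloring of \<open>U\<close> exactly once
    and are still total, so \<open>canon\<close> applies to them.\<close>
  define \<C> where "\<C> = PiE U (\<lambda>_. {..<q})"
  define T where "T = {A. A \<subseteq> {..<n} \<and> card A = m}"
  define row where "row = (\<lambda>(A, B). {\<Delta> \<in> \<C>. \<forall>a\<in>A. \<forall>b\<in>B. \<forall>b'\<in>B. \<Delta> (a, b) = \<Delta> (a, b')})"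
  define col where "col = (\<lambda>(A, B). {\<Delta> \<in> \<C>. \<forall>a\<in>A. \<forall>b\<in>B. \<forall>a'\<in>A. \<Delta> (a, b) = \<Delta> (a', b)})"
  have U: "finite U" "card U = n * n" unfolding U_def by (auto simp: card_cartesian_product)
  have "2 * m \<le> m * m" using m by simp
  then have q: "m \<le> q" unfolding q_def using m by linarith
  have T: "finite T" "card T = n choose m" unfolding T_def by (auto simp: n_subsets)
  have \<C>: "finite \<C>" "card \<C> = q ^ (n * n)"
    unfolding \<C>_def using U by (auto intro!: finite_PiE simp: card_PiE)
  obtain A0 B0 where "is_copy m n A0 B0" using canon unfolding canonical_copy_property_def by blast
  then have mn: "m \<le> n" unfolding is_copy_def by (metis card_lessThan card_mono finite_lessThan)
  have row_or_col: "\<C> \<subseteq> (\<Union>p\<in>T \<times> T. row p \<union> col p)"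
  proof
    fix \<Delta> assume \<Delta>: "\<Delta> \<in> \<C>"
    obtain A B where AB: "is_copy m n A B"
      and pat: "monochromatic \<Delta> (A \<times> B) \<or> left_colored \<Delta> (A \<times> B) \<or>
         right_colored \<Delta> (A \<times> B) \<or> rainbow \<Delta> (A \<times> B)"
      using canon unfolding canonical_copy_property_def by blast
    have sub: "A \<times> B \<subseteq> U" using AB by (auto simp: is_copy_def U_def)
    have "\<not> rainbow \<Delta> (A \<times> B)"
    proof
      assume "rainbow \<Delta> (A \<times> B)"
      then have "inj_on \<Delta> (A \<times> B)" by (auto simp: rainbow_def inj_on_def)
      moreover have "\<Delta> ` (A \<times> B) \<subseteq> {..<q}" using \<Delta> sub by (auto simp: \<C>_def)
      ultimately have "card (A \<times> B) \<le> q" by (metis card_inj_on_le card_lessThan finite_lessThan)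
      then have "m * m \<le> q" using AB by (simp add: card_cartesian_product is_copy_def)
      moreover have "m * m > 0" using m by simp
      ultimately show False unfolding q_def by linarith
    qed
    \<comment> \<open>Monochromatic and left-colored copies have constant rows; right-colored ones
      have constant columns.\<close>
    with pat have "\<Delta> \<in> row (A, B) \<union> col (A, B)"
      using \<Delta> by (auto simp: row_def col_def monochromatic_def left_colored_def right_colored_def)
    moreover have "(A, B) \<in> T \<times> T" using AB by (auto simp: is_copy_def T_def)
    ultimately show "\<Delta> \<in> (\<Union>p\<in>T \<times> T. row p \<union> col p)" by blast
  qed
  have each: "card (row p \<union> col p) \<le> 2 * q ^ (n * n - m * (m - 1))" if pT: "p \<in> T \<times> T" for p
  proof -
    obtain A B where p: "p = (A, B)" and AB: "A \<subseteq> {..<n}" "card A = m" "B \<subseteq> {..<n}" "card B = m"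
      using pT by (cases p) (auto simp: T_def)
    then obtain a0 b0 where a0: "a0 \<in> A" and b0: "b0 \<in> B"
      using m by (metis card.empty ex_in_conv not_numeral_le_zero)
    \<comment> \<open>With constant rows, the entries in column \<open>b0\<close> determine the rest
      of the copy. For constant columns the row of \<open>a0\<close> plays this part.\<close>
    have "card (row p) \<le> q ^ (card U - card (A \<times> (B - {b0})))"
    proof (rule card_determined_functions[OF U(1), where p = "\<lambda>(a, b). (a, b0)"])
      show "A \<times> (B - {b0}) \<subseteq> U" using AB by (auto simp: U_def)
      show "row p \<subseteq> PiE U (\<lambda>_. {..<q})" by (auto simp: p row_def \<C>_def)
      fix \<Delta> x assume \<Delta>: "\<Delta> \<in> row p" and x: "x \<in> A \<times> (B - {b0})"
      obtain a b where ab: "x = (a, b)" "a \<in> A" "b \<in> B" using x by blast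
      have "\<Delta> (a, b) = \<Delta> (a, b0)" using \<Delta> ab a0 b0 unfolding p row_def by blast
      moreover have "(a, b0) \<in> U" using AB ab a0 b0 by (auto simp: U_def)
      ultimately show "(\<lambda>(a, b). (a, b0)) x \<in> U - A \<times> (B - {b0}) \<and> \<Delta> x = \<Delta> ((\<lambda>(a, b). (a, b0)) x)"
        by (simp add: ab)
    qed
    moreover have "card (col p) \<le> q ^ (card U - card ((A - {a0}) \<times> B))"
    proof (rule card_determined_functions[OF U(1), where p = "\<lambda>(a, b). (a0, b)"])
      show "(A - {a0}) \<times> B \<subseteq> U" using AB by (auto simp: U_def)
      show "col p \<subseteq> PiE U (\<lambda>_. {..<q})" by (auto simp: p col_def \<C>_def)
      fix \<Delta> x assume \<Delta>: "\<Delta> \<in> col p" and x: "x \<in> (A - {a0}) \<times> B"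
      obtain a b where ab: "x = (a, b)" "a \<in> A" "b \<in> B" using x by blast
      have "\<Delta> (a, b) = \<Delta> (a0, b)" using \<Delta> ab a0 b0 unfolding p col_def by blast
      moreover have "(a0, b) \<in> U" using AB ab a0 b0 by (auto simp: U_def)
      ultimately show "(\<lambda>(a, b). (a0, b)) x \<in> U - (A - {a0}) \<times> B \<and> \<Delta> x = \<Delta> ((\<lambda>(a, b). (a0, b)) x)"
        by (simp add: ab)
    qed
    ultimately show ?thesis
      using card_Un_le[of "row p" "col p"] AB a0 b0 U
      by (simp add: card_cartesian_product mult.commute)
  qed
  have "q ^ (n * n) \<le> card (\<Union>p\<in>T \<times> T. row p \<union> col p)"
    using \<C> row_or_col T unfolding \<C>(2)[symmetric]
    by (intro card_mono) (auto simp: row_def col_def)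
  also have "\<dots> \<le> (\<Sum>p\<in>T \<times> T. card (row p \<union> col p))" using T by (intro card_UN_le) auto
  also have "\<dots> \<le> (n choose m) * (n choose m) * (2 * q ^ (n * n - m * (m - 1)))"
    using sum_bounded_above[of "T \<times> T", OF each] T by (simp add: card_cartesian_product)
  \<comment> \<open>The factor 2 is generously replaced by \<open>n ^ (2 * m)\<close>, which makes
    the product of the first three factors an m-th power.\<close>
  also have "\<dots> \<le> n ^ m * n ^ m * (n ^ (2 * m) * q ^ (n * n - m * (m - 1)))"
  proof (intro mult_mono)
    have "2 \<le> n ^ 1" using m mn by simp
    also have "\<dots> \<le> n ^ (2 * m)" using m mn by (intro power_increasing) auto
    finally show "2 \<le> n ^ (2 * m)" .
  qed (use binomial_le_pow[OF mn] in auto)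
  also have "\<dots> = (n ^ 4) ^ m * q ^ (n * n - m * (m - 1))"
    by (simp add: power_mult[symmetric] power_add[symmetric])
  \<comment> \<open>The truncated subtraction is exact since m \<le> n, so the left side is
    \<open>q ^ (n * n)\<close>.\<close>
  finally have "q ^ (n * n - m * (m - 1)) * q ^ (m * (m - 1)) \<le> (n ^ 4) ^ m * q ^ (n * n - m * (m - 1))"
    using mn by (simp flip: power_add add: mult_le_mono)
  then have "(q ^ (m - 1)) ^ m \<le> (n ^ 4) ^ m"
    using q m by (simp add: power_mult[symmetric] mult.commute)
  then have qn: "q ^ (m - 1) \<le> n ^ 4" using m by (metis power_mono_iff less_le_trans pos2 zero_le)
  \<comment> \<open>Squaring repairs the exponent \<open>m - 1\<close>: m \<le> 2(m - 1) for m \<ge>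
    2. This turns \<open>n ^ 4\<close> into \<open>n ^ 8\<close>.\<close>
  have "m ^ m \<le> m ^ ((m - 1) * 2)" using m by (intro power_increasing) auto
  also have "\<dots> \<le> (q ^ (m - 1)) ^ 2" unfolding power_mult using q by (intro power_mono) auto
  also have "\<dots> \<le> (n ^ 4) ^ 2" using qn by (intro power_mono) auto
  finally show ?thesis by (simp add: power_mult[symmetric])
qed

section \<open>The number \<open>ER_B\<close> and the final constants\<close>

text \<open>Any witness \<open>n\<close> makes the \<open>LEAST\<close> a genuine minimum. The upper
  bound construction will supply one.\<close>

lemma ER_B_spec:
  assumes "n > 0" "canonical_copy_property m n"
  shows "ER_B m > 0" "canonical_copy_property m (ER_B m)" "ER_B m \<le> n"
proof -
  have "ER_B m > 0 \<and> canonical_copy_property m (ER_B m)"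
    unfolding ER_B_def using assms by (intro LeastI[of "\<lambda>n. n > 0 \<and> canonical_copy_property m n"]) auto
  then show "ER_B m > 0" "canonical_copy_property m (ER_B m)" by auto
  show "ER_B m \<le> n" unfolding ER_B_def using assms by (intro Least_le) auto
qed

text \<open>The bounds above assume m \<ge> 2. For m = 1 the logarithm vanishes and both sides of
  the estimate equal 1, so the exact value is required.\<close>

lemma ER_B_1: "ER_B 1 = 1"
proof -
  have "canonical_copy_property 1 1"
    unfolding canonical_copy_property_def
    by (intro allI exI[of _ "{0}"]) (auto simp: is_copy_def monochromatic_def)
  then show ?thesis using ER_B_spec[of 1 1] by simp
qed

theorem theorem1p3:
  "\<exists>c c' :: real. c > 0 \<and> c' > 0 \<and>
     (\<forall>m :: nat. m > 0 \<longrightarrow>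
        2 powr (c * (real m * log 2 (real m))) \<le> real (ER_B m) \<and>
        real (ER_B m) \<le> 2 powr (c' * (real m * log 2 (real m))))"
proof (intro exI conjI allI impI)
  \<comment> \<open>The constant 1/8 comes from the eighth root of
    \<open>m ^ m \<le> ER_B m ^ 8\<close>, and 8 from
    \<open>ER_B m \<le> m ^ (8 * m)\<close>.\<close>
  show "(1/8::real) > 0" "(8::real) > 0" by simp_all
  fix m :: nat assume "m > 0"
  have powr: "2 powr (c * (real m * log 2 (real m))) = real m powr (c * real m)" for c
    using \<open>m > 0\<close> by (simp add: powr_def log_def field_simps)
  have "m = 1 \<or> m \<ge> 2" using \<open>m > 0\<close> by linarith
  then have "real m powr (1/8 * real m) \<le> real (ER_B m) \<and> real (ER_B m) \<le> real m powr (8 * real m)"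
  proof
    assume "m = 1"
    then show ?thesis using ER_B_1 by simp
  next
    assume m: "m \<ge> 2"
    note spec = ER_B_spec[OF _ canonical_copy_property_pow[OF m]]
    have pos: "ER_B m > 0" using spec(1) m by simp
    have "m ^ m \<le> ER_B m ^ 8" using canonical_copy_property_lower[OF m] spec(2) m by simp
    then have "real m ^ m \<le> real (ER_B m) ^ 8" by (metis of_nat_le_iff of_nat_power)
    then have "real m powr real m \<le> real (ER_B m) powr 8"
      using pos m by (simp add: powr_realpow)
    then have "(real m powr real m) powr (1/8) \<le> (real (ER_B m) powr 8) powr (1/8)"
      by (intro powr_mono2) auto
    then have "real m powr (1/8 * real m) \<le> real (ER_B m)"
      unfolding powr_powr using pos by (simp add: mult.commute)
    moreover have "ER_B m \<le> m ^ (8 * m)" using spec(3) m by simp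
    then have "real (ER_B m) \<le> real m ^ (8 * m)" by (metis of_nat_le_iff of_nat_power)
    then have "real (ER_B m) \<le> real m powr (8 * real m)"
      using m powr_realpow[of "real m" "8 * m"] by simp
    ultimately show ?thesis by simp
  qed
  then show "2 powr (1/8 * (real m * log 2 (real m))) \<le> real (ER_B m)"
    "real (ER_B m) \<le> 2 powr (8 * (real m * log 2 (real m)))"
    unfolding powr by auto
qed

end
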